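(* Let $\Gamma$ be a finite simple graph on $v$ vertices and let $s$ be a positive integer. Let $\mathcal{F}_s(\Gamma)$ be a set of pairs $(k,\lambda)$ of real numbers which contains every pair $(\langle k\rangle_S,\langle\lambda\rangle_S)$ arising from an $s$-clique $S$ of $\Gamma$. Let $$\mathrm{CA}_\Gamma(x,s,k,\lambda):=x(x+1)(v-s)-2xs(k-s+1)+s(s-1)(\lambda-s+2).$$ If, for every $(k,\lambda)\in\mathcal{F}_s(\Gamma)$, there exists an integer $x$ such that $\mathrm{CA}_\Gamma(x,s,k,\lambda)<0$, then $\Gamma$ contains no clique of size $s$.
   Context: For a graph $\Gamma$ and a vertex $u$, $\Gamma(u)$ denotes the set of neighbours of $u$. An $s$-clique is a set $S$ of $s$ pairwise adjacent vertices. For a clique $S$, $$\langle k\rangle_S:=\frac{1}{|S|}\sum_{u\in S}\deg_\Gamma(u),\qquad \langle\lambda\rangle_S:=\binom{|S|}{2}^{-1}\sum_{\{u,w\}\in\binom{S}{2}}|\Gamma(u)\cap\Gamma(w)|.$$ For $|S|=1$ the second average is empty and is taken to be $0$. *)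

theory Defs
  imports "Graph_Theory.Digraph" Complex_Main
begin

(* A finite simple graph is a digraph satisfying the predicate graph of Graph_Theory:
   finite, loop-free, without parallel arcs, and with symmetric adjacency, so that each
   edge is represented by a pair of opposite arcs. *)

definition neighbours :: "('a, 'b) pre_digraph \<Rightarrow> 'a \<Rightarrow> 'a set" where
  "neighbours G u = {w. u \<rightarrow>\<^bsub>G\<^esub> w}"

definition vdegree :: "('a, 'b) pre_digraph \<Rightarrow> 'a \<Rightarrow> nat" where
  "vdegree G u = card (neighbours G u)"

definition is_clique :: "('a, 'b) pre_digraph \<Rightarrow> nat \<Rightarrow> 'a set \<Rightarrow> bool" where
  "is_clique G s S \<longleftrightarrow>
     S \<subseteq> verts G \<and> finite S \<and> card S = s \<and> (\<forall>u\<in>S. \<forall>w\<in>S. u \<noteq> w \<longrightarrow> u \<rightarrow>\<^bsub>G\<^esub> w)"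

definition avg_k :: "('a, 'b) pre_digraph \<Rightarrow> 'a set \<Rightarrow> real" where
  "avg_k G S = (\<Sum>u\<in>S. real (vdegree G u)) / real (card S)"

(* The sum runs over unordered pairs e = {u, w}, for which the intersection of the
   neighbourhoods is that of u and w.  If card S = 1, the value is 0 / 0 = 0. *)
definition avg_lambda :: "('a, 'b) pre_digraph \<Rightarrow> 'a set \<Rightarrow> real" where
  "avg_lambda G S =
     (\<Sum>e\<in>{e. e \<subseteq> S \<and> card e = 2}. real (card (\<Inter>u\<in>e. neighbours G u)))
       / real (card S choose 2)"

definition CA :: "('a, 'b) pre_digraph \<Rightarrow> real \<Rightarrow> nat \<Rightarrow> real \<Rightarrow> real \<Rightarrow> real" where
  "CA G x s k l =
     x * (x + 1) * (real (card (verts G)) - real s)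
       - 2 * x * real s * (k - real s + 1)
       + real s * (real s - 1) * (l - real s + 2)"

end

theory Submission
  imports Defs
begin

text \<open>For a clique \<open>S\<close> of size \<open>s\<close> and a vertex \<open>w\<close> outside \<open>S\<close>, let \<open>n w\<close> be the number of
  neighbours of \<open>w\<close> in \<open>S\<close>.  Counting pairs and triples shows that \<open>CA\<close>, evaluated at the averages
  of \<open>S\<close>, is the sum of \<open>(x - n w) (x + 1 - n w)\<close> over all \<open>w\<close> outside \<open>S\<close>, and a product of two
  consecutive integers is never negative.\<close>

lemma sum_card_double_count:
  assumes "finite A" "finite B"
  shows "(\<Sum>a\<in>A. card {b \<in> B. R a b}) = (\<Sum>b\<in>B. card {a \<in> A. R a b})"
  using sum.swap_restrict[OF assms, of "\<lambda>_ _. 1::nat" R] by simp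

lemma real_choose_two: "2 * real (n choose 2) = real n * (real n - 1)"
  by (induction n) (simp_all add: numeral_2_eq_2 algebra_simps)

lemma consecutive_ints_mult_nonneg: "0 \<le> (z::int) * (z + 1)"
  by (cases "z \<ge> 0") (simp_all add: mult_nonpos_nonpos)

text \<open>Arcs run from the clique to \<open>w\<close>, matching the out-neighbourhoods counted by
  \<open>vdegree\<close> and \<open>avg_lambda\<close>.\<close>

definition clique_nbrs :: "('a, 'b) pre_digraph \<Rightarrow> 'a set \<Rightarrow> 'a \<Rightarrow> 'a set" where
  "clique_nbrs G S w = {u \<in> S. w \<in> neighbours G u}"

lemma neighbours_subset_verts:
  assumes "wf_digraph G"
  shows "neighbours G u \<subseteq> verts G"
  using wf_digraph.adj_in_verts(2)[OF assms] by (auto simp: neighbours_def)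

text \<open>Both sides count the pairs \<open>(u, w)\<close> with \<open>u\<close> in
  \<open>S\<close> and \<open>w\<close> a neighbour of \<open>u\<close>.\<close>

lemma sum_card_clique_nbrs:
  assumes "fin_digraph G" "finite S"
  shows "(\<Sum>w\<in>verts G. card (clique_nbrs G S w)) = (\<Sum>u\<in>S. vdegree G u)"
proof -
  interpret fin_digraph G by fact
  have "neighbours G u = {w \<in> verts G. w \<in> neighbours G u}" for u
    using neighbours_subset_verts[OF wf_digraph_axioms] by auto
  then have "vdegree G u = card {w \<in> verts G. w \<in> neighbours G u}" for u
    unfolding vdegree_def by metis
  then show ?thesis
    using sum_card_double_count[OF finite_verts assms(2), of "\<lambda>w u. w \<in> neighbours G u"]
    by (simp add: clique_nbrs_def)
qed

text \<open>Both sides count the pairs \<open>(w, e)\<close> where \<open>e\<close> is a 2-subset of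
  \<open>S\<close> and \<open>w\<close> is a common neighbour of its elements; for fixed
  \<open>w\<close> these \<open>e\<close> are the 2-subsets of
  \<open>clique_nbrs G S w\<close>.\<close>

lemma sum_choose_two_clique_nbrs:
  assumes "fin_digraph G" "finite S"
  shows "(\<Sum>w\<in>verts G. card (clique_nbrs G S w) choose 2) =
    (\<Sum>e\<in>{e. e \<subseteq> S \<and> card e = 2}. card (\<Inter>u\<in>e. neighbours G u))"
proof -
  interpret fin_digraph G by fact
  let ?E = "{e. e \<subseteq> S \<and> card e = 2}"
  have "finite ?E"
    using assms(2) by simp
  have common: "(\<Inter>u\<in>e. neighbours G u) = {w \<in> verts G. \<forall>u\<in>e. w \<in> neighbours G u}"
    if "e \<in> ?E" for e
  proof -
    \<comment> \<open>An intersection over the empty set would be the whole type and not lie in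
      \<open>verts G\<close>.\<close>
    have "e \<noteq> {}"
      using that by auto
    then show ?thesis
      using neighbours_subset_verts[OF wf_digraph_axioms] by blast
  qed
  have pairs: "card (clique_nbrs G S w) choose 2 = card {e \<in> ?E. \<forall>u\<in>e. w \<in> neighbours G u}" for w
  proof -
    have "{e \<in> ?E. \<forall>u\<in>e. w \<in> neighbours G u} = {e. e \<subseteq> clique_nbrs G S w \<and> card e = 2}"
      by (auto simp: clique_nbrs_def)
    moreover have "finite (clique_nbrs G S w)"
      using assms(2) by (simp add: clique_nbrs_def)
    ultimately show ?thesis
      by (simp add: n_subsets)
  qed
  show ?thesis
    using sum_card_double_count[OF finite_verts \<open>finite ?E\<close>, of "\<lambda>w e. \<forall>u\<in>e. w \<in> neighbours G u"]
    by (simp only: pairs common cong: sum.cong)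
qed

lemma card_clique_nbrs_inside:
  assumes "loopfree_digraph G" "is_clique G s S" "w \<in> S"
  shows "card (clique_nbrs G S w) = s - 1"
proof -
  interpret loopfree_digraph G by fact
  have "clique_nbrs G S w = S - {w}"
    using assms(2,3) adj_not_same by (fastforce simp: clique_nbrs_def neighbours_def is_clique_def)
  then show ?thesis
    using assms(2,3) by (simp add: is_clique_def)
qed

text \<open>With \<open>n\<close> short for \<open>n w\<close>, each summand expands to
  \<open>x * (x + 1) - 2 * x * n + n * (n - 1)\<close>. Over all vertices, the degrees give the sum
  of \<open>n\<close> and the common neighbours that of \<open>n * (n - 1)\<close>; the share of
  \<open>S\<close> is then subtracted. This holds for every real \<open>x\<close>.\<close>

lemma CA_clique_eq_sum:
  assumes "graph G" "is_clique G s S" "s \<ge> 1"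
  shows "CA G x s (avg_k G S) (avg_lambda G S) =
    (\<Sum>w\<in>verts G - S. (x - real (card (clique_nbrs G S w))) * (x + 1 - real (card (clique_nbrs G S w))))"
proof -
  interpret graph G by fact
  have S: "S \<subseteq> verts G" "finite S" "card S = s"
    using assms(2) by (auto simp: is_clique_def)
  define n where "n w = real (card (clique_nbrs G S w))" for w
  define L where "L = (\<Sum>e\<in>{e. e \<subseteq> S \<and> card e = 2}. real (card (\<Inter>u\<in>e. neighbours G u)))"
  have inside: "n w = real s - 1" if "w \<in> S" for w
    using card_clique_nbrs_inside[OF loopfree_digraph_axioms assms(2) that] assms(3)
    by (simp add: n_def of_nat_diff)
  have "(\<Sum>w\<in>verts G. n w) = (\<Sum>u\<in>S. real (vdegree G u))"
    using arg_cong[OF sum_card_clique_nbrs[OF fin_digraph_axioms S(2)], of real]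
    by (simp add: n_def)
  then have k: "(\<Sum>w\<in>verts G. n w) = real s * avg_k G S"
    using assms(3) S(3) by (simp add: avg_k_def)
  have "(\<Sum>w\<in>verts G. real (card (clique_nbrs G S w) choose 2)) = L"
    using arg_cong[OF sum_choose_two_clique_nbrs[OF fin_digraph_axioms S(2)], of real]
    by (simp add: L_def)
  then have "(\<Sum>w\<in>verts G. n w * (n w - 1)) = 2 * L"
    unfolding n_def real_choose_two[symmetric] sum_distrib_left[symmetric] by simp
  moreover have "real s * (real s - 1) * avg_lambda G S = 2 * L"
  \<comment> \<open>For \<open>s = 1\<close> the average is 0 / 0, but the factor
    \<open>s - 1\<close> makes the left side 0, and \<open>L\<close> is an empty sum.\<close>
  proof (cases "s = 1")
    case True
    have no_pairs: "{e. e \<subseteq> S \<and> card e = 2} = {}"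
      by (auto dest: card_mono[OF S(2)] simp: S(3) True)
    show ?thesis
      unfolding L_def no_pairs using True by simp
  next
    case False
    then have "s choose 2 \<noteq> 0"
      using assms(3) by (simp add: binomial_eq_0_iff)
    then show ?thesis
      by (simp add: avg_lambda_def L_def S(3) flip: real_choose_two)
  qed
  ultimately have l: "(\<Sum>w\<in>verts G. n w * (n w - 1)) = real s * (real s - 1) * avg_lambda G S"
    by simp
  have outside: "(\<Sum>w\<in>verts G - S. f w) = (\<Sum>w\<in>verts G. f w) - (\<Sum>w\<in>S. f w)" for f :: "'a \<Rightarrow> real"
    using S(1) by (simp add: sum_diff)
  have "(\<Sum>w\<in>verts G - S. (x - n w) * (x + 1 - n w))
      = (\<Sum>w\<in>verts G - S. x * (x + 1) - 2 * x * n w + n w * (n w - 1))"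
    by (intro sum.cong) (auto simp: algebra_simps)
  also have "\<dots> = x * (x + 1) * (real (card (verts G)) - real s)
      - 2 * x * (\<Sum>w\<in>verts G - S. n w) + (\<Sum>w\<in>verts G - S. n w * (n w - 1))"
    unfolding sum.distrib sum_subtractf sum_distrib_left[symmetric]
    using S card_mono[OF finite_verts S(1)] by (simp add: card_Diff_subset of_nat_diff algebra_simps)
  \<comment> \<open>Each of the \<open>s\<close> clique vertices has \<open>n w = s - 1\<close>, so
    \<open>S\<close> accounts for \<open>s * (s - 1)\<close> here and for
    \<open>s * (s - 1) * (s - 2)\<close> in the quadratic sum; hence the shifts by
    \<open>s - 1\<close> and \<open>s - 2\<close> in \<open>CA\<close>.\<close>
  also have "(\<Sum>w\<in>verts G - S. n w) = real s * (avg_k G S - real s + 1)"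
    unfolding outside k by (simp add: inside S(3) algebra_simps)
  also have "(\<Sum>w\<in>verts G - S. n w * (n w - 1)) = real s * (real s - 1) * (avg_lambda G S - real s + 2)"
    unfolding outside l by (simp add: inside S(3) algebra_simps)
  finally show ?thesis
    by (simp add: CA_def n_def mult.assoc)
qed

theorem theorem1p1:
  fixes G :: "('a, 'b) pre_digraph" and s :: nat and F :: "(real \<times> real) set"
  assumes "graph G"
    and "s \<ge> 1"
    and "\<And>S. is_clique G s S \<Longrightarrow> (avg_k G S, avg_lambda G S) \<in> F"
    and "\<And>k l. (k, l) \<in> F \<Longrightarrow> \<exists>x :: int. CA G (real_of_int x) s k l < 0"
  shows "\<not> (\<exists>S. is_clique G s S)"
proof
  assume "\<exists>S. is_clique G s S"
  then obtain S where S: "is_clique G s S" ..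
  obtain x :: int where x: "CA G (real_of_int x) s (avg_k G S) (avg_lambda G S) < 0"
    using assms(3,4) S by blast
  have "0 \<le> (real_of_int x - real m) * (real_of_int x + 1 - real m)" for m
  proof -
    \<comment> \<open>Integrality of \<open>x\<close> enters here: for real \<open>z\<close>
      strictly between -1 and 0 the product \<open>z * (z + 1)\<close> is negative, so the bound is
      proved for the integer \<open>z = x - m\<close> and then cast.\<close>
    have "real_of_int ((x - int m) * (x - int m + 1))
        = (real_of_int x - real m) * (real_of_int x + 1 - real m)"
      by (simp add: algebra_simps)
    then show ?thesis
      by (metis consecutive_ints_mult_nonneg of_int_0_le_iff)
  qed
  then have "0 \<le> CA G (real_of_int x) s (avg_k G S) (avg_lambda G S)"
    unfolding CA_clique_eq_sum[OF assms(1) S assms(2)] by (intro sum_nonneg) blast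
  with x show False
    by simp
qed

end
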